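(* Let $d\geq 1$ and let $G$ be a weakly connected $d$-regular digraph. For every integer $n\geq 1$, $Z(L^n(G))=\gamma_P(L^{n+1}(G))$. Moreover, if $d\geq 2$, then $Z(L^n(G))=\gamma_P(L^{n+1}(G))=(d-1)\,d^{n-1}\,|V(G)|$.
   Context: A digraph $G$ has a finite non-empty vertex set $V(G)$ and a set $A(G)\subseteq V(G)\times V(G)$ of arcs; loops $(u,u)$ are allowed. $N^+_G(v)=\{u:(v,u)\in A(G)\}$, $N^-_G(v)=\{w:(w,v)\in A(G)\}$, $N^+_G[v]=N^+_G(v)\cup\{v\}$, $N^+_G[S]=\bigcup_{v\in S}N^+_G[v]$. $G$ is $d$-regular if $|N^+_G(v)|=|N^-_G(v)|=d$ for all $v$. $G$ is weakly connected if its underlying undirected graph is connected. Line digraph: $L(G)$ has vertex set $\{uv:(u,v)\in A(G)\}$, with an arc from $uv$ to $xy$ exactly when $v=x$. $L^0(G)=G$ and $L^r(G)=L(L^{r-1}(G))$ for $r\geq 1$. Zero forcing in a digraph $H$: for non-empty $S\subseteq V(H)$ put $B^0(S)=S$ and, for $i\ge 0$: if $H$ has no loops, $B^{i+1}(S)=B^i(S)\cup\{v\in V(H)\setminus B^i(S):\exists u\in B^i(S),\ N^+_H(u)\setminus B^i(S)=\{v\}\}$; if $H$ has at least one loop, $B^{i+1}(S)=B^i(S)\cup\{v\in V(H)\setminus B^i(S):\exists u\in V(H),\ N^+_H(u)\setminus B^i(S)=\{v\}\}$. $S$ is a zero forcing set if $B^m(S)=V(H)$ for some $m\ge 0$. $Z(H)$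 is the minimum cardinality of a zero forcing set of $H$ (in particular the sets considered are non-empty). Power domination in $H$: for non-empty $S\subseteq V(H)$ put $P^0(S)=S$, $P^1(S)=N^+_H[S]$, and for $i\geq 1$ obtain $P^{i+1}(S)$ from $P^i(S)$ by the same rule by which $B^{i+1}(S)$ is obtained from $B^i(S)$ (the loopless rule if $H$ has no loops, the other rule if $H$ has at least one loop). $S$ is a power dominating set if $P^t(S)=V(H)$ for some $t\ge 0$; equivalently, $N^+_H[S]$ is a zero forcing set. $\gamma_P(H)$ is the minimum cardinality of a (non-empty) power dominating set of $H$. *)

theory Defs
  imports "Graph_Theory.Digraph_Component"
begin

definition out_nbrs :: "'a pair_pre_digraph \<Rightarrow> 'a \<Rightarrow> 'a set" where
  "out_nbrs G v = {u. (v, u) \<in> parcs G}"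

definition in_nbrs :: "'a pair_pre_digraph \<Rightarrow> 'a \<Rightarrow> 'a set" where
  "in_nbrs G v = {w. (w, v) \<in> parcs G}"

definition closed_out_nbrs :: "'a pair_pre_digraph \<Rightarrow> 'a set \<Rightarrow> 'a set" where
  "closed_out_nbrs G S = (\<Union>v\<in>S. insert v (out_nbrs G v))"

definition regular_digraph :: "nat \<Rightarrow> 'a pair_pre_digraph \<Rightarrow> bool" where
  "regular_digraph d G \<longleftrightarrow>
     (\<forall>v\<in>pverts G. card (out_nbrs G v) = d \<and> card (in_nbrs G v) = d)"

definition has_loop :: "'a pair_pre_digraph \<Rightarrow> bool" where
  "has_loop G \<longleftrightarrow> (\<exists>v\<in>pverts G. (v, v) \<in> parcs G)"


definition line_digraph :: "'a pair_pre_digraph \<Rightarrow> ('a \<times> 'a) pair_pre_digraph" where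
  "line_digraph G =
     \<lparr> pverts = parcs G,
       parcs = {(e, f). e \<in> parcs G \<and> f \<in> parcs G \<and> snd e = fst f} \<rparr>"

text \<open>
  The line digraph changes the type of the vertices, so it cannot be iterated as it stands.
  The datatype below contains the vertices of all iterates at once: its elements are the
  vertices of the original digraph and formal ordered pairs of elements.  The iterates are
  relabelled along the (injective) constructors; the zeroth one is a copy of the
  original digraph.
\<close>

datatype 'a line_vertex = Base 'a | ArcVertex "'a line_vertex" "'a line_vertex"

definition relabel :: "('a \<Rightarrow> 'b) \<Rightarrow> 'a pair_pre_digraph \<Rightarrow> 'b pair_pre_digraph" where
  "relabel f G = \<lparr> pverts = f ` pverts G, parcs = map_prod f f ` parcs G \<rparr>"

primrec iter_line_digraph :: "nat \<Rightarrow> 'a pair_pre_digraph \<Rightarrow> 'a line_vertex pair_pre_digraph" where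
  "iter_line_digraph 0 G = relabel Base G"
| "iter_line_digraph (Suc r) G =
     relabel (\<lambda>(u, v). ArcVertex u v) (line_digraph (iter_line_digraph r G))"


text \<open>
  In a digraph without loops only vertices of the current set may force; if there is at
  least one loop anywhere in the digraph, every vertex may force.
\<close>

definition force_step :: "'a pair_pre_digraph \<Rightarrow> 'a set \<Rightarrow> 'a set" where
  "force_step H B =
     B \<union> {v \<in> pverts H - B.
           \<exists>u \<in> (if has_loop H then pverts H else B). out_nbrs H u - B = {v}}"

definition zero_forcing_set :: "'a pair_pre_digraph \<Rightarrow> 'a set \<Rightarrow> bool" where
  "zero_forcing_set H S \<longleftrightarrow>
     S \<noteq> {} \<and> S \<subseteq> pverts H \<and> (\<exists>m. (force_step H ^^ m) S = pverts H)"

definition zero_forcing_number :: "'a pair_pre_digraph \<Rightarrow> nat" where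
  "zero_forcing_number H = (LEAST k. \<exists>S. zero_forcing_set H S \<and> card S = k)"

fun power_dom_seq :: "'a pair_pre_digraph \<Rightarrow> 'a set \<Rightarrow> nat \<Rightarrow> 'a set" where
  "power_dom_seq H S 0 = S"
| "power_dom_seq H S (Suc 0) = closed_out_nbrs H S"
| "power_dom_seq H S (Suc (Suc i)) = force_step H (power_dom_seq H S (Suc i))"

definition power_dominating_set :: "'a pair_pre_digraph \<Rightarrow> 'a set \<Rightarrow> bool" where
  "power_dominating_set H S \<longleftrightarrow>
     S \<noteq> {} \<and> S \<subseteq> pverts H \<and> (\<exists>t. power_dom_seq H S t = pverts H)"

definition power_domination_number :: "'a pair_pre_digraph \<Rightarrow> nat" where
  "power_domination_number H = (LEAST k. \<exists>S. power_dominating_set H S \<and> card S = k)"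

end

theory Submission
  imports Defs
begin

text \<open>
  Every \<open>d\<close>-regular, strongly connected digraph \<open>K\<close> on \<open>N\<close> vertices satisfies
  \<open>Z(L(K)) = max 1 ((d - 1) N) = \<gamma>\<^sub>P(L(L(K)))\<close>.  A weakly connected regular digraph is strongly
  connected, line digraphs inherit both properties, and \<open>L\<^sup>r(G)\<close> has \<open>d\<^sup>r |V(G)|\<close> vertices, so the
  theorem is the case \<open>K = L\<^sup>n\<^sup>-\<^sup>1(G)\<close>.  The maximum with \<open>1\<close> reflects that forcing and dominating
  sets are non-empty; it matters exactly when \<open>d = 1\<close>.

  The vertices of \<open>L(K)\<close> are partitioned into the stars \<open>E\<^sup>+(v)\<close> of arcs leaving a vertex \<open>v\<close>
  of \<open>K\<close>, and the out-neighbourhood of any arc that enters \<open>v\<close> is the whole star \<open>E\<^sup>+(v)\<close>.  Two arcs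
  missing in the same star therefore block each other for ever.  Conversely, if every star
  misses at most one arc of a non-empty set, then one coloured arc entering \<open>v\<close> completes \<open>E\<^sup>+(v)\<close>,
  whose arcs then complete the stars at the out-neighbours of \<open>v\<close>, and strong connectivity carries
  this through \<open>K\<close>.  So a non-empty set of arcs is zero forcing in \<open>L(K)\<close> precisely when it misses
  at most one arc of each star (\<open>zero_forcing_set_line_digraph_iff\<close>), whether or not there are
  loops.  This gives the value of \<open>Z\<close>.

  A set \<open>S\<close> of arcs of \<open>K\<close> is then power dominating in \<open>L(K)\<close> precisely when its closed
  neighbourhood has that property.  A star \<open>E\<^sup>+(v)\<close> is dealt with either by an arc of \<open>S\<close> entering
  \<open>v\<close> or by \<open>d - 1\<close> arcs of \<open>S\<close> leaving \<open>v\<close>.  Counting arcs of \<open>S\<close> by head with weight \<open>d - 1\<close>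
  and by tail with weight \<open>1\<close> yields \<open>(d - 1) |V(K)| \<le> d |S|\<close>; applied to \<open>L(K)\<close>, which has
  \<open>d N\<close> vertices, this is the lower bound \<open>(d - 1) N\<close> for \<open>L(L(K))\<close>.

  For the upper bound, Hall's theorem provides a set \<open>F\<close> of arcs of \<open>K\<close>, exactly one leaving and one
  entering each vertex.  Take the pairs \<open>(e, f)\<close> of consecutive arcs with \<open>e \<in> F\<close> and \<open>f \<notin> F\<close>.  There
  is one such pair for each arc \<open>f\<close> outside \<open>F\<close>, so there are \<open>(d - 1) N\<close>.  They enter every vertex
  \<open>f \<notin> F\<close> of \<open>L(K)\<close>, and \<open>d - 1\<close> of them leave every vertex \<open>e \<in> F\<close>.
\<close>

section \<open>Hall's marriage theorem and permutations along arcs\<close>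

text \<open>
  Rado's proof.  As long as some \<open>A i\<close> has two elements \<open>x\<close> and \<open>y\<close>, one of them can be deleted:
  if both deletions violated the condition, say at \<open>J \<union> {i}\<close> and \<open>K \<union> {i}\<close>, then the condition for
  \<open>J \<union> K \<union> {i}\<close> and for \<open>J \<inter> K\<close> would contradict
  \<open>card P + card Q = card (P \<union> Q) + card (P \<inter> Q)\<close>.  When all \<open>A i\<close> are singletons, there is
  only one choice of representatives.
\<close>

theorem Hall_marriage:
  fixes A :: "'i \<Rightarrow> 'b set"
  assumes "finite I" and "\<And>i. i \<in> I \<Longrightarrow> finite (A i)"
    and "\<And>J. J \<subseteq> I \<Longrightarrow> card J \<le> card (\<Union>(A ` J))"
  shows "\<exists>f. inj_on f I \<and> (\<forall>i\<in>I. f i \<in> A i)"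
  using assms(2,3)
proof (induction "\<Sum>i\<in>I. card (A i)" arbitrary: A rule: less_induct)
  case less
  note fin = less.prems(1) and hall = less.prems(2)
  show ?case
  proof (cases "\<exists>i\<in>I. \<exists>x\<in>A i. \<exists>y\<in>A i. x \<noteq> y")
    case False
    have ne: "A i \<noteq> {}" if "i \<in> I" for i
      using hall[of "{i}"] that by auto
    define f where "f i = (SOME x. x \<in> A i)" for i
    have fA: "f i \<in> A i" if "i \<in> I" for i
      using ne[OF that] unfolding f_def by (simp add: some_in_eq)
    have Af: "A i = {f i}" if "i \<in> I" for i
      using False fA that by blast
    have "inj_on f I"
    proof (rule inj_onI, rule ccontr)
      fix i j assume ij: "i \<in> I" "j \<in> I" "f i = f j" "i \<noteq> j"
      have "card {i, j} \<le> card (\<Union>(A ` {i, j}))"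
        using ij by (intro hall) auto
      then show False using ij Af by auto
    qed
    then show ?thesis using fA by blast
  next
    case True
    then obtain i x y where i: "i \<in> I" and xy: "x \<in> A i" "y \<in> A i" "x \<noteq> y" by blast
    define D where "D z = A(i := A i - {z})" for z
    have Dfin: "finite (D z j)" if "j \<in> I" for z j
      using fin that by (auto simp: D_def)
    have smaller: "(\<Sum>j\<in>I. card (D z j)) < (\<Sum>j\<in>I. card (A j))" if "z \<in> A i" for z
    proof (rule sum_strict_mono_ex1[OF assms(1)])
      show "\<forall>j\<in>I. card (D z j) \<le> card (A j)"
        using fin by (auto simp: D_def intro!: card_mono)
      have "card (D z i) < card (A i)"
        using that fin[OF i] by (intro psubset_card_mono) (auto simp: D_def)
      then show "\<exists>j\<in>I. card (D z j) < card (A j)" using i by blast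
    qed
    have DA: "D z j \<subseteq> A j" for z j by (auto simp: D_def)
    have finU: "finite (\<Union>(A ` J))" if "J \<subseteq> I" for J
      using that fin assms(1) by (auto intro: finite_subset)
    have step: ?thesis if z: "z \<in> A i" and h: "\<forall>J \<subseteq> I. card J \<le> card (\<Union>(D z ` J))" for z
    proof -
      have "\<exists>f. inj_on f I \<and> (\<forall>j\<in>I. f j \<in> D z j)"
      proof (rule less.hyps[of "D z"])
        show "(\<Sum>j\<in>I. card (D z j)) < (\<Sum>j\<in>I. card (A j))" by (rule smaller[OF z])
        show "finite (D z j)" if "j \<in> I" for j using that by (rule Dfin)
        show "card J \<le> card (\<Union>(D z ` J))" if "J \<subseteq> I" for J using that h by simp
      qed
      then show ?thesis using DA[of z] by (meson subsetD)
    qed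
    \<comment> \<open>A set of indices that violates the condition after a deletion from \<open>A i\<close> contains \<open>i\<close>.\<close>
    have viol: "\<exists>J \<subseteq> I - {i}. card (\<Union>(A ` J) \<union> (A i - {z})) \<le> card J"
      if nv: "\<not> (\<forall>J \<subseteq> I. card J \<le> card (\<Union>(D z ` J)))" for z
    proof -
      obtain J where J: "J \<subseteq> I" "card (\<Union>(D z ` J)) < card J"
        using nv by (auto simp: not_le)
      have iJ: "i \<in> J"
      proof (rule ccontr)
        assume "i \<notin> J"
        then have "\<Union>(D z ` J) = \<Union>(A ` J)" by (auto simp: D_def)
        then show False using J hall by (metis leD)
      qed
      have "\<Union>(D z ` J) = \<Union>(A ` (J - {i})) \<union> (A i - {z})"
        using iJ by (auto simp: D_def split: if_splits)
      moreover have "card J = Suc (card (J - {i}))"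
        using iJ J(1) assms(1) by (metis card.remove finite_subset)
      ultimately show ?thesis using J by (intro exI[of _ "J - {i}"]) auto
    qed
    show ?thesis
    proof (rule ccontr)
      assume no: "\<not> ?thesis"
      have nx: "\<not> (\<forall>J \<subseteq> I. card J \<le> card (\<Union>(D x ` J)))"
        using step[OF xy(1)] no by (rule contrapos_nn[rotated])
      have ny: "\<not> (\<forall>J \<subseteq> I. card J \<le> card (\<Union>(D y ` J)))"
        using step[OF xy(2)] no by (rule contrapos_nn[rotated])
      obtain J where J: "J \<subseteq> I - {i}" and cJ: "card (\<Union>(A ` J) \<union> (A i - {x})) \<le> card J"
        using viol[OF nx] by auto
      obtain K where K: "K \<subseteq> I - {i}" and cK: "card (\<Union>(A ` K) \<union> (A i - {y})) \<le> card K"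
        using viol[OF ny] by auto
      let ?P = "\<Union>(A ` J) \<union> (A i - {x})" and ?Q = "\<Union>(A ` K) \<union> (A i - {y})"
      have finJK: "finite J" "finite K" using J K assms(1) by (auto intro: finite_subset)
      have finPQ: "finite ?P" "finite ?Q"
        using finU[of J] finU[of K] J K i fin by auto
      have "card (insert i (J \<union> K)) \<le> card (\<Union>(A ` insert i (J \<union> K)))"
        using J K i by (intro hall) auto
      also have "\<Union>(A ` insert i (J \<union> K)) = ?P \<union> ?Q"
        using xy by auto
      finally have u: "Suc (card (J \<union> K)) \<le> card (?P \<union> ?Q)"
        using J K finJK by (subst (asm) card_insert_disjoint) auto
      have "card (J \<inter> K) \<le> card (\<Union>(A ` (J \<inter> K)))"
        using J by (intro hall) auto
      also have "\<dots> \<le> card (?P \<inter> ?Q)"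
        using finPQ by (intro card_mono) auto
      finally have n: "card (J \<inter> K) \<le> card (?P \<inter> ?Q)" .
      have "card J + card K = card (J \<union> K) + card (J \<inter> K)"
        by (rule card_Un_Int[OF finJK])
      moreover have "card ?P + card ?Q = card (?P \<union> ?Q) + card (?P \<inter> ?Q)"
        by (rule card_Un_Int[OF finPQ])
      ultimately show False using u n cJ cK by linarith
    qed
  qed
qed

lemma card_out_arcs: "card (out_arcs (with_proj G) v) = card (out_nbrs G v)"
proof -
  have "out_arcs (with_proj G) v = Pair v ` out_nbrs G v"
    by (auto simp: out_arcs_def out_nbrs_def)
  then show ?thesis by (simp add: card_image inj_on_def)
qed

lemma card_in_arcs: "card (in_arcs (with_proj G) v) = card (in_nbrs G v)"
proof -
  have "in_arcs (with_proj G) v = (\<lambda>u. (u, v)) ` in_nbrs G v"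
    by (auto simp: in_arcs_def in_nbrs_def)
  then show ?thesis by (simp add: card_image inj_on_def)
qed

locale pair_regular_digraph = pair_fin_digraph G for G :: "'a pair_pre_digraph" +
  fixes d :: nat
  assumes pos: "d \<ge> 1" and regular: "regular_digraph d G"
begin

lemma card_arcs_from:
  assumes "X \<subseteq> pverts G" shows "card {e \<in> parcs G. fst e \<in> X} = d * card X"
proof -
  have "{e \<in> parcs G. fst e \<in> X} = (\<Union>v\<in>X. out_arcs (with_proj G) v)"
    by (auto simp: out_arcs_def)
  also have "card \<dots> = (\<Sum>v\<in>X. card (out_arcs (with_proj G) v))"
    using assms pair_finite_verts pair_finite_arcs
    by (intro card_UN_disjoint) (auto simp: out_arcs_def intro: finite_subset)
  also have "\<dots> = (\<Sum>v\<in>X. d)"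
    using assms regular by (intro sum.cong) (auto simp: card_out_arcs regular_digraph_def)
  finally show ?thesis by simp
qed

lemma card_arcs_into:
  assumes "X \<subseteq> pverts G" shows "card {e \<in> parcs G. snd e \<in> X} = d * card X"
proof -
  have "{e \<in> parcs G. snd e \<in> X} = (\<Union>v\<in>X. in_arcs (with_proj G) v)"
    by (auto simp: in_arcs_def)
  also have "card \<dots> = (\<Sum>v\<in>X. card (in_arcs (with_proj G) v))"
    using assms pair_finite_verts pair_finite_arcs
    by (intro card_UN_disjoint) (auto simp: in_arcs_def intro: finite_subset)
  also have "\<dots> = (\<Sum>v\<in>X. d)"
    using assms regular by (intro sum.cong) (auto simp: card_in_arcs regular_digraph_def)
  finally show ?thesis by simp
qed

lemma card_arcs: "card (parcs G) = d * card (pverts G)"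
proof -
  have "{e \<in> parcs G. fst e \<in> pverts G} = parcs G" by (auto dest: arc_fst_in_verts)
  then show ?thesis using card_arcs_from[of "pverts G"] by simp
qed

text \<open>
  The marriage condition holds because the \<open>d |J|\<close> arcs leaving \<open>J\<close> are among the \<open>d |N|\<close> arcs
  that enter the out-neighbourhood \<open>N\<close> of \<open>J\<close>.
\<close>

lemma arc_permutation:
  obtains g where "bij_betw g (pverts G) (pverts G)" and "\<And>v. v \<in> pverts G \<Longrightarrow> (v, g v) \<in> parcs G"
proof -
  have nb: "out_nbrs G v \<subseteq> pverts G" for v
    by (auto simp: out_nbrs_def dest: in_arcsD2)
  have "\<exists>g. inj_on g (pverts G) \<and> (\<forall>v\<in>pverts G. g v \<in> out_nbrs G v)"
  proof (rule Hall_marriage[OF pair_finite_verts])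
    show "finite (out_nbrs G v)" for v
      using nb pair_finite_verts by (rule finite_subset)
    fix J assume J: "J \<subseteq> pverts G"
    let ?N = "\<Union>(out_nbrs G ` J)"
    have "d * card J = card {e \<in> parcs G. fst e \<in> J}" using card_arcs_from[OF J] by simp
    also have "\<dots> \<le> card {e \<in> parcs G. snd e \<in> ?N}"
      using pair_finite_arcs by (intro card_mono) (auto simp: out_nbrs_def)
    also have "\<dots> = d * card ?N"
      using nb by (intro card_arcs_into) auto
    finally show "card J \<le> card ?N" using pos by simp
  qed
  then obtain g where g: "inj_on g (pverts G)" "\<And>v. v \<in> pverts G \<Longrightarrow> g v \<in> out_nbrs G v" by blast
  have "g ` pverts G \<subseteq> pverts G" using g(2) nb by blast
  then have "bij_betw g (pverts G) (pverts G)"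
    using g(1) endo_inj_surj[OF pair_finite_verts] unfolding bij_betw_def by blast
  then show ?thesis
    by (rule that) (use g(2) in \<open>simp add: out_nbrs_def\<close>)
qed

text \<open>
  The graph of such a permutation is a system of disjoint cycles that covers all vertices.  For
  \<open>d \<ge> 2\<close> its complement is a minimum zero forcing set of the line digraph.
\<close>

lemma one_factor:
  obtains F where "F \<subseteq> parcs G" and "inj_on fst F" and "inj_on snd F"
    and "snd ` F = pverts G" and "card (parcs G - F) = (d - 1) * card (pverts G)"
proof -
  obtain g where bij: "bij_betw g (pverts G) (pverts G)"
    and g: "\<And>v. v \<in> pverts G \<Longrightarrow> (v, g v) \<in> parcs G"
    by (rule arc_permutation) blast
  define F where "F = (\<lambda>v. (v, g v)) ` pverts G"
  have F: "F \<subseteq> parcs G" using g by (auto simp: F_def)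
  have "card F = card (pverts G)" by (auto simp: F_def card_image inj_on_def)
  then have "card (parcs G - F) = (d - 1) * card (pverts G)"
    using F card_arcs pair_finite_arcs
    by (simp add: card_Diff_subset finite_subset diff_mult_distrib)
  moreover have "inj_on fst F" by (auto simp: F_def inj_on_def)
  moreover have "inj_on snd F"
    using bij_betw_imp_inj_on[OF bij] by (auto simp: F_def inj_on_def)
  moreover have "snd ` F = pverts G"
    using bij_betw_imp_surj_on[OF bij] by (simp add: F_def image_image)
  ultimately show ?thesis using F that by blast
qed

end

section \<open>Strong connectivity\<close>

definition out_closed :: "'a pair_pre_digraph \<Rightarrow> 'a set \<Rightarrow> bool" where
  "out_closed G X \<longleftrightarrow> X \<subseteq> pverts G \<and> (\<forall>(u, v) \<in> parcs G. u \<in> X \<longrightarrow> v \<in> X)"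

text \<open>
  In terms of out-closed sets, strong connectivity is applied, and checked for a line digraph,
  without handling walks.
\<close>

lemma (in pair_wf_digraph) strongly_connected_iff_out_closed:
  "strongly_connected (with_proj G) \<longleftrightarrow>
     pverts G \<noteq> {} \<and> (\<forall>X. X \<noteq> {} \<longrightarrow> out_closed G X \<longrightarrow> X = pverts G)"
proof
  assume sc: "strongly_connected (with_proj G)"
  show "pverts G \<noteq> {} \<and> (\<forall>X. X \<noteq> {} \<longrightarrow> out_closed G X \<longrightarrow> X = pverts G)"
  proof (intro conjI allI impI)
    show "pverts G \<noteq> {}" using sc by (simp add: strongly_connected_def)
    fix X assume X: "X \<noteq> {}" "out_closed G X"
    then obtain u where u: "u \<in> X" by blast
    have "v \<in> X" if "v \<in> pverts G" for v
    proof -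
      have "u \<rightarrow>\<^sup>*\<^bsub>with_proj G\<^esub> v"
        using sc u X(2) that by (auto simp: strongly_connected_def out_closed_def)
      then show ?thesis
        by (induction rule: reachable_induct) (use u X(2) in \<open>auto simp: out_closed_def\<close>)
    qed
    then show "X = pverts G" using X(2) by (auto simp: out_closed_def)
  qed
next
  assume r: "pverts G \<noteq> {} \<and> (\<forall>X. X \<noteq> {} \<longrightarrow> out_closed G X \<longrightarrow> X = pverts G)"
  have "u \<rightarrow>\<^sup>*\<^bsub>with_proj G\<^esub> v" if uv: "u \<in> pverts G" "v \<in> pverts G" for u v
  proof -
    let ?X = "{w. u \<rightarrow>\<^sup>*\<^bsub>with_proj G\<^esub> w}"
    have "?X = pverts G"
    proof (rule r[THEN conjunct2, rule_format])
      show "out_closed G ?X"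
        by (auto simp: out_closed_def reachable_in_verts intro: reachable_adj_trans)
      have "u \<in> ?X" using uv(1) by simp
      then show "?X \<noteq> {}" by (metis empty_iff)
    qed
    then show ?thesis using uv(2) by auto
  qed
  then show "strongly_connected (with_proj G)"
    using r by (simp add: strongly_connected_def)
qed

text \<open>
  An out-closed set \<open>X\<close> in a regular digraph receives no arc from outside: the
  \<open>d |X|\<close> arcs leaving vertices of \<open>X\<close> all enter \<open>X\<close>, and only \<open>d |X|\<close> arcs enter \<open>X\<close>.  So \<open>X\<close> is
  also closed under arcs taken backwards.
\<close>

lemma (in pair_regular_digraph) connected_imp_strongly_connected:
  assumes "connected (with_proj G)"
  shows "strongly_connected (with_proj G)"
  unfolding strongly_connected_iff_out_closed
proof (intro conjI allI impI)
  let ?S = "mk_symmetric (with_proj G)"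
  interpret S: pair_wf_digraph ?S by (rule wellformed_mk_symmetric)
  have S: "pverts G \<noteq> {}" "\<And>X. X \<noteq> {} \<Longrightarrow> out_closed ?S X \<Longrightarrow> X = pverts G"
    using assms by (auto simp: connected_def S.strongly_connected_iff_out_closed)
  show "pverts G \<noteq> {}" by (rule S(1))
  fix X assume X: "X \<noteq> {}" "out_closed G X"
  then have XV: "X \<subseteq> pverts G" by (simp add: out_closed_def)
  let ?out = "{e \<in> parcs G. fst e \<in> X}" and ?in = "{e \<in> parcs G. snd e \<in> X}"
  have "?out = ?in"
  proof (rule card_subset_eq)
    show "finite ?in" using pair_finite_arcs by simp
    show "?out \<subseteq> ?in" using X(2) by (auto simp: out_closed_def)
    show "card ?out = card ?in" using card_arcs_from[OF XV] card_arcs_into[OF XV] by simp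
  qed
  then have "u \<in> X \<longleftrightarrow> v \<in> X" if "(u, v) \<in> parcs G" for u v
    using that by (auto simp: set_eq_iff)
  then have "out_closed ?S X"
    using XV by (auto simp: out_closed_def parcs_mk_symmetric)
  then show "X = pverts G" using X(1) S(2) by blast
qed

section \<open>Line digraphs of strongly connected regular digraphs\<close>

lemma pverts_line_digraph [simp]: "pverts (line_digraph G) = parcs G"
  by (simp add: line_digraph_def)

lemma parcs_line_digraph:
  "(e, f) \<in> parcs (line_digraph G) \<longleftrightarrow> e \<in> parcs G \<and> f \<in> parcs G \<and> snd e = fst f"
  by (simp add: line_digraph_def)

lemma out_nbrs_line_digraph:
  "e \<in> parcs G \<Longrightarrow> out_nbrs (line_digraph G) e = out_arcs (with_proj G) (snd e)"
  by (auto simp: out_nbrs_def out_arcs_def parcs_line_digraph)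

lemma in_nbrs_line_digraph:
  "e \<in> parcs G \<Longrightarrow> in_nbrs (line_digraph G) e = in_arcs (with_proj G) (fst e)"
  by (auto simp: in_nbrs_def in_arcs_def parcs_line_digraph)

lemma pair_fin_digraph_line_digraph:
  assumes "finite (parcs G)" shows "pair_fin_digraph (line_digraph G)"
proof
  show "finite (parcs (line_digraph G))"
    by (rule finite_subset[of _ "parcs G \<times> parcs G"]) (use assms in \<open>auto simp: parcs_line_digraph\<close>)
qed (use assms in \<open>auto simp: parcs_line_digraph\<close>)

locale pair_strong_regular_digraph = pair_regular_digraph +
  assumes strong: "strongly_connected (with_proj G)"
begin

lemma verts_nonempty: "pverts G \<noteq> {}"
  using strong by (simp add: strongly_connected_def)

lemma out_closed_eq: "X \<noteq> {} \<Longrightarrow> out_closed G X \<Longrightarrow> X = pverts G"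
  using strong by (simp add: strongly_connected_iff_out_closed)

lemma card_out_arcs_eq: "v \<in> pverts G \<Longrightarrow> card (out_arcs (with_proj G) v) = d"
  using regular by (simp add: card_out_arcs regular_digraph_def)

lemma card_in_arcs_eq: "v \<in> pverts G \<Longrightarrow> card (in_arcs (with_proj G) v) = d"
  using regular by (simp add: card_in_arcs regular_digraph_def)

lemma arcs_nonempty: "parcs G \<noteq> {}"
proof -
  have "card (parcs G) > 0"
    using card_arcs pos verts_nonempty pair_finite_verts by (simp add: card_gt_0_iff)
  then show ?thesis by force
qed

text \<open>
  If a set \<open>X\<close> of arcs contains all arcs that follow one of its members, then the heads of its
  members form an out-closed set of \<open>G\<close>, so every vertex is such a head.
\<close>

lemma line_digraph_strong_regular: "pair_strong_regular_digraph (line_digraph G) d"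
proof -
  interpret L: pair_fin_digraph "line_digraph G"
    using pair_finite_arcs by (rule pair_fin_digraph_line_digraph)
  show ?thesis
  proof
    show "d \<ge> 1" by (rule pos)
    show "regular_digraph d (line_digraph G)"
      unfolding regular_digraph_def
      by (auto simp: out_nbrs_line_digraph in_nbrs_line_digraph
          intro!: card_out_arcs_eq card_in_arcs_eq dest: in_arcsD1 in_arcsD2)
    show "strongly_connected (with_proj (line_digraph G))"
      unfolding L.strongly_connected_iff_out_closed
    proof (intro conjI allI impI)
      show "pverts (line_digraph G) \<noteq> {}" using arcs_nonempty by simp
      fix X assume ne: "X \<noteq> {}" and "out_closed (line_digraph G) X"
      then have XA: "X \<subseteq> parcs G"
        and cl: "\<And>e f. e \<in> X \<Longrightarrow> f \<in> parcs G \<Longrightarrow> snd e = fst f \<Longrightarrow> f \<in> X"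
        by (force simp: out_closed_def parcs_line_digraph)+
      have "out_closed G (snd ` X)"
        unfolding out_closed_def
      proof (intro conjI ballI)
        show "snd ` X \<subseteq> pverts G" using XA arc_snd_in_verts by blast
        fix f assume "f \<in> parcs G"
        then show "case f of (u, v) \<Rightarrow> u \<in> snd ` X \<longrightarrow> v \<in> snd ` X"
          using cl[of _ f] by force
      qed
      with ne have heads: "snd ` X = pverts G" by (intro out_closed_eq) simp_all
      have "f \<in> X" if f: "f \<in> parcs G" for f
      proof -
        obtain e where "e \<in> X" "snd e = fst f"
          using heads arc_fst_in_verts[OF f] by (metis imageE)
        then show ?thesis using cl[of e f] f by blast
      qed
      then show "X = pverts (line_digraph G)" using XA by auto
    qed
  qed
qed

end

section \<open>Zero forcing\<close>

lemma subset_force_step: "B \<subseteq> force_step H B"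
  by (auto simp: force_step_def)

lemma force_step_subset_verts: "B \<subseteq> pverts H \<Longrightarrow> force_step H B \<subseteq> pverts H"
  by (auto simp: force_step_def)

lemma funpow_force_step_subset_verts:
  "S \<subseteq> pverts H \<Longrightarrow> (force_step H ^^ m) S \<subseteq> pverts H"
  by (induction m) (simp_all add: force_step_subset_verts)

lemma subset_funpow_force_step: "S \<subseteq> (force_step H ^^ m) S"
  by (induction m) (auto intro: subsetD[OF subset_force_step])

lemma funpow_force_step_stabilises:
  assumes "finite (pverts H)" "S \<subseteq> pverts H"
  obtains m where "force_step H ((force_step H ^^ m) S) = (force_step H ^^ m) S"
proof -
  let ?B = "\<lambda>m. (force_step H ^^ m) S"
  have sub: "?B m \<subseteq> pverts H" for m by (rule funpow_force_step_subset_verts[OF assms(2)])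
  have "\<exists>m. \<forall>n. card (?B n) \<le> card (?B m)"
    using ex_has_greatest_nat[of "\<lambda>_. True" 0 "\<lambda>m. card (?B m)" "Suc (card (pverts H))"]
      card_mono[OF assms(1) sub] by (auto simp: less_Suc_eq_le)
  then obtain m where m: "\<And>n. card (?B n) \<le> card (?B m)" by blast
  have "?B m = ?B (Suc m)"
    using m[of "Suc m"] subset_force_step[of "?B m" H] finite_subset[OF sub assms(1), of "Suc m"]
    by (intro card_seteq) auto
  then show ?thesis using that[of m] by simp
qed

context pair_strong_regular_digraph
begin

text \<open>
  Necessity: two arcs missing in one star have the same in-neighbours in the line digraph.
  Sufficiency: once the colouring is stable, every coloured arc has a completely coloured star at
  its head, so the vertices with a completely coloured star form an out-closed set.
\<close>

lemma zero_forcing_set_line_digraph_iff: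
  "zero_forcing_set (line_digraph G) S \<longleftrightarrow>
     S \<noteq> {} \<and> S \<subseteq> parcs G \<and> (\<forall>v\<in>pverts G. card (out_arcs (with_proj G) v - S) \<le> 1)"
    (is "?L \<longleftrightarrow> ?R")
proof
  let ?H = "line_digraph G" and ?O = "out_arcs (with_proj G)"
  assume zf: ?L
  then obtain m where m: "(force_step ?H ^^ m) S = parcs G" and S: "S \<noteq> {}" "S \<subseteq> parcs G"
    by (auto simp: zero_forcing_set_def)
  have "card (?O v - S) \<le> 1" for v
  proof (rule ccontr)
    assume "\<not> card (?O v - S) \<le> 1"
    then obtain p q where pq: "p \<in> ?O v - S" "q \<in> ?O v - S" "p \<noteq> q"
      using finite_out_arcs[of v] by (metis One_nat_def card_le_Suc0_iff_eq finite_Diff)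
    \<comment> \<open>An arc with \<open>p\<close> among its out-neighbours also has \<open>q\<close>, so neither is ever forced.\<close>
    have stuck: "p \<notin> force_step ?H B \<and> q \<notin> force_step ?H B"
      if BG: "B \<subseteq> parcs G" and pqB: "p \<notin> B \<and> q \<notin> B" for B
    proof -
      have "out_nbrs ?H e - B \<noteq> {p} \<and> out_nbrs ?H e - B \<noteq> {q}" if e: "e \<in> parcs G" for e
      proof -
        have "p \<in> out_nbrs ?H e \<longleftrightarrow> q \<in> out_nbrs ?H e"
          using pq e by (auto simp: out_nbrs_line_digraph out_arcs_def)
        then show ?thesis using pq(3) pqB by (metis DiffD1 DiffI singletonD singletonI)
      qed
      then show ?thesis using BG pqB by (auto simp: force_step_def split: if_splits)
    qed
    have "p \<notin> (force_step ?H ^^ k) S \<and> q \<notin> (force_step ?H ^^ k) S" for k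
    proof (induction k)
      case 0 then show ?case using pq by simp
    next
      case (Suc k)
      then show ?case
        using stuck funpow_force_step_subset_verts[of S ?H k] S(2) by simp
    qed
    then show False using m pq(1) by (auto simp: out_arcs_def)
  qed
  then show ?R using S by blast
next
  let ?H = "line_digraph G" and ?O = "out_arcs (with_proj G)"
  assume R: ?R
  then have SV: "S \<subseteq> pverts ?H" by simp
  obtain m where m: "force_step ?H ((force_step ?H ^^ m) S) = (force_step ?H ^^ m) S"
    using funpow_force_step_stabilises[OF _ SV] pair_finite_arcs by auto
  define B where "B = (force_step ?H ^^ m) S"
  have SB: "S \<subseteq> B" unfolding B_def by (rule subset_funpow_force_step)
  have BV: "B \<subseteq> parcs G" using funpow_force_step_subset_verts[OF SV] by (simp add: B_def)
  have spread: "?O (snd e) \<subseteq> B" if e: "e \<in> B" for e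
  proof (rule ccontr)
    assume n: "\<not> ?O (snd e) \<subseteq> B"
    have eA: "e \<in> parcs G" using e BV by blast
    have "card (?O (snd e) - B) \<le> card (?O (snd e) - S)"
      using SB finite_out_arcs by (intro card_mono) auto
    also have "\<dots> \<le> 1" using R arc_snd_in_verts[OF eA] by blast
    finally obtain f where f: "?O (snd e) - B = {f}"
      using n finite_out_arcs[of "snd e"]
      by (metis Diff_eq_empty_iff card_1_singletonE card_eq_0_iff finite_Diff le_neq_implies_less less_one)
    have fA: "f \<in> parcs G" "f \<notin> B" using f by (auto simp: out_arcs_def)
    moreover have "out_nbrs ?H e - B = {f}" using f by (simp add: out_nbrs_line_digraph[OF eA])
    ultimately have "f \<in> force_step ?H B"
      using e eA by (auto simp: force_step_def)
    then show False using f m by (auto simp: B_def)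
  qed
  let ?X = "{v \<in> pverts G. ?O v \<subseteq> B}"
  have "out_closed G ?X"
    unfolding out_closed_def
  proof (intro conjI ballI, safe)
    fix u v f assume "(u, v) \<in> parcs G" "?O u \<subseteq> B"
    then have "(u, v) \<in> B" by (auto simp: out_arcs_def)
    then show "f \<in> ?O v \<Longrightarrow> f \<in> B" "v \<in> pverts G"
      using spread[of "(u, v)"] \<open>(u, v) \<in> parcs G\<close> in_arcsD2 by auto
  qed
  moreover have "?X \<noteq> {}"
  proof -
    obtain e where "e \<in> S" using R by blast
    then have "e \<in> B" "snd e \<in> pverts G" using SB BV arc_snd_in_verts by blast+
    then have "snd e \<in> ?X" using spread by blast
    then show ?thesis by blast
  qed
  ultimately have X: "?X = pverts G" by (intro out_closed_eq)
  have "e \<in> B" if "e \<in> parcs G" for e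
  proof -
    have "fst e \<in> ?X" using X arc_fst_in_verts[OF that] by blast
    then show ?thesis using that by (auto simp: out_arcs_def)
  qed
  then have "B = pverts ?H" using BV by auto
  then show ?L using R by (auto simp: zero_forcing_set_def B_def)
qed

text \<open>
  At most one arc per vertex may be left out, and a one-factor leaves out exactly one.  If this
  leaves nothing, which happens for \<open>d = 1\<close>, any single arc is a zero forcing set.
\<close>

lemma zero_forcing_number_line_digraph:
  "zero_forcing_number (line_digraph G) = max 1 ((d - 1) * card (pverts G))"
  unfolding zero_forcing_number_def
proof (rule Least_equality)
  let ?O = "out_arcs (with_proj G)"
  obtain F where F: "F \<subseteq> parcs G" "inj_on fst F"
    and cAF: "card (parcs G - F) = (d - 1) * card (pverts G)"
    by (rule one_factor)
  have one: "card (?O v - S) \<le> 1" if S: "parcs G - F \<subseteq> S" for v S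
  proof -
    obtain f where f: "\<And>f'. f' \<in> F \<Longrightarrow> fst f' = v \<Longrightarrow> f' = f"
      using F(2) by (metis inj_onD)
    have "?O v - S \<subseteq> {f}"
    proof
      fix x assume "x \<in> ?O v - S"
      then have "x \<in> F" "fst x = v" using S by (auto simp: out_arcs_def)
      then show "x \<in> {f}" using f by simp
    qed
    then show ?thesis using card_mono[of "{f}" "?O v - S"] by simp
  qed
  show "\<exists>S. zero_forcing_set (line_digraph G) S \<and> card S = max 1 ((d - 1) * card (pverts G))"
  proof (cases "parcs G - F = {}")
    case True
    obtain e where e: "e \<in> parcs G" using arcs_nonempty by blast
    have "zero_forcing_set (line_digraph G) {e}"
      using e one True by (auto simp: zero_forcing_set_line_digraph_iff)
    moreover have "(d - 1) * card (pverts G) = 0" using True cAF by (metis card.empty)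
    ultimately show ?thesis by (intro exI[of _ "{e}"]) simp
  next
    case False
    have "zero_forcing_set (line_digraph G) (parcs G - F)"
      using False one by (auto simp: zero_forcing_set_line_digraph_iff)
    moreover have "card (parcs G - F) \<ge> 1"
      using False pair_finite_arcs by (simp add: Suc_le_eq card_gt_0_iff)
    ultimately show ?thesis using cAF by (intro exI[of _ "parcs G - F"]) simp
  qed
next
  let ?O = "out_arcs (with_proj G)"
  fix k assume "\<exists>S. zero_forcing_set (line_digraph G) S \<and> card S = k"
  then obtain S where S: "S \<noteq> {}" "S \<subseteq> parcs G" and k: "card S = k"
    and le: "\<And>v. v \<in> pverts G \<Longrightarrow> card (?O v - S) \<le> 1"
    by (auto simp: zero_forcing_set_line_digraph_iff)
  have fS: "finite S" using S(2) pair_finite_arcs by (rule finite_subset)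
  have "parcs G - S = (\<Union>v\<in>pverts G. ?O v - S)"
    by (auto simp: out_arcs_def dest: in_arcsD1)
  then have "card (parcs G - S) \<le> (\<Sum>v\<in>pverts G. card (?O v - S))"
    using card_UN_le[OF pair_finite_verts] by metis
  also have "\<dots> \<le> (\<Sum>v\<in>pverts G. 1)" by (intro sum_mono le)
  finally have "d * card (pverts G) - card S \<le> card (pverts G)"
    using S fS by (simp add: card_Diff_subset card_arcs)
  moreover have "card S \<ge> 1" using S fS by (simp add: Suc_le_eq card_gt_0_iff)
  ultimately show "max 1 ((d - 1) * card (pverts G)) \<le> k"
    using k by (simp add: diff_mult_distrib)
qed

end

section \<open>Power domination\<close>

lemma power_dom_seq_Suc: "power_dom_seq H S (Suc i) = (force_step H ^^ i) (closed_out_nbrs H S)"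
  by (induction i) auto

lemma (in pair_wf_digraph) closed_out_nbrs_subset:
  "S \<subseteq> pverts G \<Longrightarrow> closed_out_nbrs G S \<subseteq> pverts G"
  by (auto simp: closed_out_nbrs_def out_nbrs_def dest: in_arcsD2)

lemma (in pair_wf_digraph) power_dominating_set_iff:
  "power_dominating_set G S \<longleftrightarrow>
     S \<noteq> {} \<and> S \<subseteq> pverts G \<and> zero_forcing_set G (closed_out_nbrs G S)"
proof -
  have sup: "S \<subseteq> closed_out_nbrs G S" by (auto simp: closed_out_nbrs_def)
  have "(\<exists>t. power_dom_seq G S t = pverts G) \<longleftrightarrow>
      (\<exists>m. (force_step G ^^ m) (closed_out_nbrs G S) = pverts G)" if S: "S \<subseteq> pverts G"
  proof
    assume "\<exists>t. power_dom_seq G S t = pverts G"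
    then obtain t where t: "power_dom_seq G S t = pverts G" by blast
    show "\<exists>m. (force_step G ^^ m) (closed_out_nbrs G S) = pverts G"
    proof (cases t)
      case 0
      then have "(force_step G ^^ 0) (closed_out_nbrs G S) = pverts G"
        using t sup closed_out_nbrs_subset[OF S] by simp
      then show ?thesis by blast
    next
      case (Suc i)
      then show ?thesis using t power_dom_seq_Suc by metis
    qed
  next
    assume "\<exists>m. (force_step G ^^ m) (closed_out_nbrs G S) = pverts G"
    then show "\<exists>t. power_dom_seq G S t = pverts G" using power_dom_seq_Suc by metis
  qed
  then show ?thesis
    using sup closed_out_nbrs_subset[of S]
    by (auto simp: power_dominating_set_def zero_forcing_set_def)
qed

context pair_strong_regular_digraph
begin

lemma power_dominating_set_line_digraph_iff:
  "power_dominating_set (line_digraph G) S \<longleftrightarrow>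
     S \<noteq> {} \<and> S \<subseteq> parcs G \<and>
     (\<forall>v\<in>pverts G. card (out_arcs (with_proj G) v - closed_out_nbrs (line_digraph G) S) \<le> 1)"
proof -
  interpret L: pair_strong_regular_digraph "line_digraph G" d
    by (rule line_digraph_strong_regular)
  have "S \<subseteq> closed_out_nbrs (line_digraph G) S" by (auto simp: closed_out_nbrs_def)
  then show ?thesis
    using L.closed_out_nbrs_subset[of S]
    unfolding L.power_dominating_set_iff zero_forcing_set_line_digraph_iff by auto
qed

lemma closed_out_nbrs_line_digraph:
  assumes "S \<subseteq> parcs G"
  shows "closed_out_nbrs (line_digraph G) S = S \<union> {e \<in> parcs G. \<exists>s\<in>S. snd s = fst e}"
  using assms by (auto simp: closed_out_nbrs_def out_nbrs_def parcs_line_digraph)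

text \<open>
  With \<open>a v\<close> and \<open>b v\<close> the numbers of arcs of \<open>S\<close> leaving and entering \<open>v\<close>, the claim is the sum over
  all vertices of \<open>d - 1 \<le> (d - 1) * b v + a v\<close>.  This holds because without an arc of \<open>S\<close> into
  \<open>v\<close> the star of \<open>v\<close> meets the closed neighbourhood only in \<open>S\<close> itself, and must do so in at least
  \<open>d - 1\<close> arcs.
\<close>

lemma power_dominating_set_line_digraph_lower_bound:
  assumes "power_dominating_set (line_digraph G) S"
  shows "(d - 1) * card (pverts G) \<le> d * card S"
proof -
  let ?O = "out_arcs (with_proj G)" and ?C = "closed_out_nbrs (line_digraph G) S"
  have S: "S \<subseteq> parcs G" and le: "\<And>v. v \<in> pverts G \<Longrightarrow> card (?O v - ?C) \<le> 1"
    using assms by (auto simp: power_dominating_set_line_digraph_iff)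
  have fS: "finite S" using S pair_finite_arcs by (rule finite_subset)
  define a where "a v = card {e \<in> S. fst e = v}" for v
  define b where "b v = card {e \<in> S. snd e = v}" for v
  have sum_a: "(\<Sum>v\<in>pverts G. a v) = card S"
    unfolding a_def card_eq_sum using S arc_fst_in_verts
    by (intro sum.group[OF fS pair_finite_verts]) blast
  have sum_b: "(\<Sum>v\<in>pverts G. b v) = card S"
    unfolding b_def card_eq_sum using S arc_snd_in_verts
    by (intro sum.group[OF fS pair_finite_verts]) blast
  have vert: "d - 1 \<le> (d - 1) * b v + a v" if v: "v \<in> pverts G" for v
  proof (cases "b v = 0")
    case True
    then have "{e \<in> S. snd e = v} = {}" using fS by (simp add: b_def)
    then have "?O v - ?C = ?O v - {e \<in> S. fst e = v}"
      by (auto simp: closed_out_nbrs_line_digraph[OF S] out_arcs_def)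
    moreover have "{e \<in> S. fst e = v} \<subseteq> ?O v" using S by (auto simp: out_arcs_def)
    ultimately have "d - a v \<le> 1"
      using le[OF v] fS card_out_arcs_eq[OF v] by (simp add: a_def card_Diff_subset)
    then show ?thesis by simp
  next
    case False
    then have "(d - 1) * 1 \<le> (d - 1) * b v" by (intro mult_le_mono2) simp
    then show ?thesis by linarith
  qed
  have "(d - 1) * card (pverts G) = (\<Sum>v\<in>pverts G. d - 1)" by simp
  also have "\<dots> \<le> (\<Sum>v\<in>pverts G. (d - 1) * b v + a v)" by (intro sum_mono vert)
  also have "\<dots> = (d - 1) * card S + card S"
    by (simp add: sum.distrib sum_a sum_b flip: sum_distrib_left)
  also have "\<dots> = d * card S" using pos by (cases d) auto
  finally show ?thesis .
qed

text \<open>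
  The set is \<open>{(e, f). e \<in> F \<and> f \<notin> F}\<close> for a one-factor \<open>F\<close>.  A vertex \<open>f \<notin> F\<close> of the line digraph is
  entered from the unique arc of \<open>F\<close> ending at the tail of \<open>f\<close>, so its star is dominated; the star of
  \<open>e \<in> F\<close> misses only the arc to the successor of \<open>e\<close> in \<open>F\<close>.
\<close>

lemma power_dominating_set_line_line_digraph_exists:
  "\<exists>S. power_dominating_set (line_digraph (line_digraph G)) S
       \<and> card S \<le> max 1 ((d - 1) * card (pverts G))"
proof -
  interpret L: pair_strong_regular_digraph "line_digraph G" d
    by (rule line_digraph_strong_regular)
  let ?O = "out_arcs (with_proj (line_digraph G))"
    and ?C = "closed_out_nbrs (line_digraph (line_digraph G))"
  obtain F where F: "F \<subseteq> parcs G" "inj_on fst F" "inj_on snd F" "snd ` F = pverts G"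
    and cAF: "card (parcs G - F) = (d - 1) * card (pverts G)"
    by (rule one_factor)
  define S where "S = {(e, f) \<in> parcs (line_digraph G). e \<in> F \<and> f \<notin> F}"
  have SA: "S \<subseteq> parcs (line_digraph G)" by (auto simp: S_def)
  have cS: "card S \<le> card (parcs G - F)"
  proof (rule card_inj_on_le)
    show "inj_on snd S"
    proof (rule inj_onI)
      fix p q assume "p \<in> S" "q \<in> S" "snd p = snd q"
      then have "fst p \<in> F" "fst q \<in> F" "snd (fst p) = snd (fst q)"
        by (auto simp: S_def parcs_line_digraph)
      then have "fst p = fst q" using F(3) by (blast dest: inj_onD)
      then show "p = q" using \<open>snd p = snd q\<close> by (simp add: prod_eq_iff)
    qed
    show "snd ` S \<subseteq> parcs G - F" by (auto simp: S_def parcs_line_digraph)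
    show "finite (parcs G - F)" using pair_finite_arcs by simp
  qed
  \<comment> \<open>Supersets of \<open>S\<close> are included because \<open>S\<close> is empty when \<open>d = 1\<close>.\<close>
  have one: "card (?O e - ?C S') \<le> 1"
    if e: "e \<in> pverts (line_digraph G)" and S': "S \<subseteq> S'" "S' \<subseteq> parcs (line_digraph G)" for e S'
  proof -
    have eA: "e \<in> parcs G" using e by simp
    show ?thesis
    proof (cases "e \<in> F")
      case True
      obtain f where f: "\<And>f'. f' \<in> F \<Longrightarrow> fst f' = snd e \<Longrightarrow> f' = f"
        using F(2) by (metis inj_onD)
      have "?O e - ?C S' \<subseteq> {(e, f)}"
      proof
        fix x assume x: "x \<in> ?O e - ?C S'"
        define f' where "f' = snd x"
        have "fst x = e" "x \<in> parcs (line_digraph G)" using x by (simp_all add: out_arcs_def)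
        then have xe: "x = (e, f')" and "(e, f') \<in> parcs (line_digraph G)"
          by (auto simp: f'_def)
        then have f': "f' \<in> parcs G" "fst f' = snd e" by (simp_all add: parcs_line_digraph)
        have "x \<notin> S'" using x by (simp add: L.closed_out_nbrs_line_digraph[OF S'(2)])
        then have "(e, f') \<notin> S" using xe S'(1) by auto
        then have "f' \<in> F" using True f' eA by (simp add: S_def parcs_line_digraph)
        then show "x \<in> {(e, f)}" using f f' xe by simp
      qed
      then show ?thesis using card_mono[of "{(e, f)}" "?O e - ?C S'"] by simp
    next
      case False
      obtain m where m: "m \<in> F" "snd m = fst e"
        using F(4) arc_fst_in_verts[OF eA] by (metis imageE)
      then have "(m, e) \<in> S'"
        using False eA F(1) S'(1) by (auto simp: S_def parcs_line_digraph)
      then have "?O e \<subseteq> ?C S'"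
        using L.closed_out_nbrs_line_digraph[OF S'(2)] by (force simp: out_arcs_def)
      then have "?O e - ?C S' = {}" by blast
      then show ?thesis by (metis card.empty zero_le)
    qed
  qed
  show ?thesis
  proof (cases "S = {}")
    case True
    obtain m where m: "m \<in> parcs (line_digraph G)" using L.arcs_nonempty by blast
    have "power_dominating_set (line_digraph (line_digraph G)) {m}"
      using one[of _ "{m}"] m True by (auto simp: L.power_dominating_set_line_digraph_iff)
    then show ?thesis by (intro exI[of _ "{m}"]) simp
  next
    case False
    have "power_dominating_set (line_digraph (line_digraph G)) S"
      using one[of _ S] SA False by (auto simp: L.power_dominating_set_line_digraph_iff)
    then show ?thesis using cS cAF by (intro exI[of _ S]) simp
  qed
qed

lemma power_domination_number_line_line_digraph:
  "power_domination_number (line_digraph (line_digraph G)) = max 1 ((d - 1) * card (pverts G))"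
  unfolding power_domination_number_def
proof (rule Least_equality)
  interpret L: pair_strong_regular_digraph "line_digraph G" d
    by (rule line_digraph_strong_regular)
  have lower: "max 1 ((d - 1) * card (pverts G)) \<le> card S"
    if S: "power_dominating_set (line_digraph (line_digraph G)) S" for S
  proof -
    have "d * ((d - 1) * card (pverts G)) \<le> d * card S"
      using L.power_dominating_set_line_digraph_lower_bound[OF S]
      by (simp add: card_arcs mult.left_commute)
    then have "(d - 1) * card (pverts G) \<le> card S" using pos by simp
    moreover have "card S \<ge> 1"
      using S finite_subset[OF _ L.pair_finite_arcs, of S]
      by (simp add: power_dominating_set_def Suc_le_eq card_gt_0_iff)
    ultimately show ?thesis by simp
  qed
  show "\<exists>S. power_dominating_set (line_digraph (line_digraph G)) S
      \<and> card S = max 1 ((d - 1) * card (pverts G))"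
    using power_dominating_set_line_line_digraph_exists lower by (meson le_antisym)
  show "max 1 ((d - 1) * card (pverts G)) \<le> k"
    if "\<exists>S. power_dominating_set (line_digraph (line_digraph G)) S \<and> card S = k" for k
    using that lower by blast
qed

end

section \<open>Relabelling and iteration\<close>

lemma pverts_relabel: "pverts (relabel f G) = f ` pverts G"
  by (simp add: relabel_def)

lemma parcs_relabel: "parcs (relabel f G) = map_prod f f ` parcs G"
  by (simp add: relabel_def)

context
  fixes f :: "'a \<Rightarrow> 'b"
  assumes inj: "inj f"
begin

lemma out_nbrs_relabel: "out_nbrs (relabel f G) (f v) = f ` out_nbrs G v"
  using inj by (auto simp: out_nbrs_def parcs_relabel dest: injD)

lemma in_nbrs_relabel: "in_nbrs (relabel f G) (f v) = f ` in_nbrs G v"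
  using inj by (auto simp: in_nbrs_def parcs_relabel dest: injD)

lemma has_loop_relabel: "has_loop (relabel f G) \<longleftrightarrow> has_loop G"
  using inj by (force simp: has_loop_def pverts_relabel parcs_relabel dest: injD)

lemma force_step_relabel: "force_step (relabel f G) (f ` B) = f ` force_step G B"
proof -
  have key: "(out_nbrs (relabel f G) (f u) - f ` B = {f v}) \<longleftrightarrow> (out_nbrs G u - B = {v})" for u v
  proof -
    have "out_nbrs (relabel f G) (f u) - f ` B = f ` (out_nbrs G u - B)"
      by (simp add: out_nbrs_relabel image_set_diff[OF inj])
    then show ?thesis using inj_image_eq_iff[OF inj, of "out_nbrs G u - B" "{v}"] by simp
  qed
  have filter: "{w \<in> f ` A. Q w} = f ` {a \<in> A. Q (f a)}" for A Q by blast
  have "{w \<in> f ` pverts G - f ` B. \<exists>u \<in> f ` U. out_nbrs (relabel f G) u - f ` B = {w}}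
      = f ` {v \<in> pverts G - B. \<exists>u \<in> U. out_nbrs G u - B = {v}}" for U
    unfolding image_set_diff[OF inj, symmetric] filter by (simp add: key)
  then show ?thesis
    by (simp add: force_step_def has_loop_relabel pverts_relabel image_Un)
qed

lemma closed_out_nbrs_relabel:
  "closed_out_nbrs (relabel f G) (f ` S) = f ` closed_out_nbrs G S"
  by (auto simp: closed_out_nbrs_def out_nbrs_relabel)

lemma zero_forcing_set_relabel:
  "zero_forcing_set (relabel f G) (f ` S) \<longleftrightarrow> zero_forcing_set G S"
proof -
  have "(force_step (relabel f G) ^^ m) (f ` S) = f ` (force_step G ^^ m) S" for m
    by (induction m) (simp_all add: force_step_relabel)
  then show ?thesis
    using inj by (simp add: zero_forcing_set_def pverts_relabel inj_image_eq_iff inj_image_subset_iff)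
qed

lemma power_dominating_set_relabel:
  "power_dominating_set (relabel f G) (f ` S) \<longleftrightarrow> power_dominating_set G S"
proof -
  have "power_dom_seq (relabel f G) (f ` S) t = f ` power_dom_seq G S t" for t
    by (induction G S t rule: power_dom_seq.induct)
      (simp_all add: force_step_relabel closed_out_nbrs_relabel)
  then show ?thesis
    using inj
    by (simp add: power_dominating_set_def pverts_relabel inj_image_eq_iff inj_image_subset_iff)
qed

text \<open>
  The shape of this equivalence is that of the predicate minimised by both graph parameters, so
  that it transfers either minimum along \<open>f\<close>.
\<close>

lemma card_image_family_relabel:
  assumes "\<And>S. Q (f ` S) \<longleftrightarrow> P S" and "\<And>T. Q T \<Longrightarrow> T \<subseteq> range f"
  shows "(\<exists>T. Q T \<and> card T = k) \<longleftrightarrow> (\<exists>S. P S \<and> card S = k)"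
proof -
  have c: "card (f ` S) = card S" for S
    using inj by (intro card_image) (auto intro: inj_on_subset)
  show ?thesis using assms c by (metis subset_imageE)
qed

lemma zero_forcing_number_relabel:
  "zero_forcing_number (relabel f G) = zero_forcing_number G"
  unfolding zero_forcing_number_def
  by (subst card_image_family_relabel[where P = "zero_forcing_set G"])
    (auto simp: zero_forcing_set_relabel, auto simp: zero_forcing_set_def pverts_relabel)

lemma power_domination_number_relabel:
  "power_domination_number (relabel f G) = power_domination_number G"
  unfolding power_domination_number_def
  by (subst card_image_family_relabel[where P = "power_dominating_set G"])
    (auto simp: power_dominating_set_relabel, auto simp: power_dominating_set_def pverts_relabel)

lemma line_digraph_relabel:
  "line_digraph (relabel f G) = relabel (map_prod f f) (line_digraph G)"
proof (rule pair_pre_digraph.equality)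
  show "parcs (line_digraph (relabel f G)) = parcs (relabel (map_prod f f) (line_digraph G))"
  proof (intro set_eqI iffI)
    fix x assume "x \<in> parcs (line_digraph (relabel f G))"
    then obtain a b c d where "x = ((f a, f b), (f c, f d))" "(a, b) \<in> parcs G" "(c, d) \<in> parcs G"
      and "f b = f c"
      by (auto simp: parcs_relabel line_digraph_def)
    moreover from this have "b = c" using inj by (simp add: inj_eq)
    ultimately show "x \<in> parcs (relabel (map_prod f f) (line_digraph G))"
      by (auto simp: parcs_relabel parcs_line_digraph intro!: image_eqI[of _ _ "((a, b), (c, d))"])
  qed (auto simp: parcs_relabel line_digraph_def)
qed (simp_all add: pverts_relabel parcs_relabel)

lemma strong_regular_relabel:
  assumes "pair_strong_regular_digraph G d"
  shows "pair_strong_regular_digraph (relabel f G) d"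
proof -
  interpret pair_strong_regular_digraph G d by fact
  have c: "card (f ` X) = card X" for X
    using inj by (intro card_image) (auto intro: inj_on_subset)
  interpret R: pair_fin_digraph "relabel f G"
    using pair_finite_verts pair_finite_arcs
    by unfold_locales (auto simp: pverts_relabel parcs_relabel dest: in_arcsD1 in_arcsD2)
  show ?thesis
  proof
    show "d \<ge> 1" by (rule pos)
    show "regular_digraph d (relabel f G)"
      using regular
      by (simp add: regular_digraph_def pverts_relabel out_nbrs_relabel in_nbrs_relabel c)
    show "strongly_connected (with_proj (relabel f G))"
      unfolding R.strongly_connected_iff_out_closed
    proof (intro conjI allI impI)
      show "pverts (relabel f G) \<noteq> {}" using verts_nonempty by (simp add: pverts_relabel)
      fix X assume X: "X \<noteq> {}" "out_closed (relabel f G) X"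
      then obtain Y where Y: "Y \<subseteq> pverts G" "X = f ` Y"
        by (metis out_closed_def pverts_relabel subset_imageE)
      have "out_closed G Y"
        unfolding out_closed_def
      proof (intro conjI ballI)
        show "Y \<subseteq> pverts G" by (rule Y(1))
        fix e assume "e \<in> parcs G"
        then have "map_prod f f e \<in> parcs (relabel f G)" by (simp add: parcs_relabel)
        then have "case map_prod f f e of (u, v) \<Rightarrow> u \<in> X \<longrightarrow> v \<in> X"
          by (rule bspec[OF X(2)[unfolded out_closed_def, THEN conjunct2]])
        then show "case e of (u, v) \<Rightarrow> u \<in> Y \<longrightarrow> v \<in> Y"
          unfolding Y(2) by (cases e) (simp add: inj_image_mem_iff[OF inj])
      qed
      moreover have "Y \<noteq> {}" using X(1) Y(2) by simp
      ultimately have "Y = pverts G" by (intro out_closed_eq)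
      then show "X = pverts (relabel f G)" by (simp add: Y(2) pverts_relabel)
    qed
  qed
qed

end

lemma inj_Base: "inj Base"
  by (simp add: inj_def)

lemma inj_ArcVertex: "inj (\<lambda>(u, v). ArcVertex u v)"
  by (auto simp: inj_def)

lemma iter_line_digraph_strong_regular:
  assumes "pair_strong_regular_digraph G d"
  shows "pair_strong_regular_digraph (iter_line_digraph n G) d"
  using assms
  by (induction n)
    (auto intro: strong_regular_relabel inj_Base inj_ArcVertex
      pair_strong_regular_digraph.line_digraph_strong_regular)

lemma card_verts_iter_line_digraph:
  assumes "pair_strong_regular_digraph G d"
  shows "card (pverts (iter_line_digraph n G)) = d ^ n * card (pverts G)"
proof (induction n)
  case 0
  show ?case by (simp add: pverts_relabel card_image inj_on_def)
next
  case (Suc n)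
  interpret pair_strong_regular_digraph "iter_line_digraph n G" d
    by (rule iter_line_digraph_strong_regular[OF assms])
  show ?case
    using card_arcs Suc by (simp add: pverts_relabel card_image inj_on_subset[OF inj_ArcVertex])
qed

lemma iter_line_digraph_numbers:
  assumes "pair_strong_regular_digraph G d"
  shows "zero_forcing_number (iter_line_digraph (Suc n) G) = max 1 ((d - 1) * (d ^ n * card (pverts G)))"
    and "power_domination_number (iter_line_digraph (Suc (Suc n)) G)
           = max 1 ((d - 1) * (d ^ n * card (pverts G)))"
proof -
  interpret pair_strong_regular_digraph "iter_line_digraph n G" d
    by (rule iter_line_digraph_strong_regular[OF assms])
  show "zero_forcing_number (iter_line_digraph (Suc n) G)
      = max 1 ((d - 1) * (d ^ n * card (pverts G)))"
    using zero_forcing_number_line_digraph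
    by (simp add: zero_forcing_number_relabel[OF inj_ArcVertex] card_verts_iter_line_digraph[OF assms])
  show "power_domination_number (iter_line_digraph (Suc (Suc n)) G)
      = max 1 ((d - 1) * (d ^ n * card (pverts G)))"
    using power_domination_number_line_line_digraph
    by (simp add: power_domination_number_relabel[OF inj_ArcVertex]
        power_domination_number_relabel[OF prod.inj_map[OF inj_ArcVertex inj_ArcVertex]]
        line_digraph_relabel[OF inj_ArcVertex]
        card_verts_iter_line_digraph[OF assms])
qed

theorem corollary4p11:
  fixes G :: "'a pair_pre_digraph" and d :: nat
  assumes "pair_fin_digraph G"
    and "pverts G \<noteq> {}"
    and "connected (with_proj G)"
    and "d \<ge> 1"
    and "regular_digraph d G"
  shows "(\<forall>n\<ge>1. zero_forcing_number (iter_line_digraph n G)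
                 = power_domination_number (iter_line_digraph (n + 1) G))
       \<and> (d \<ge> 2 \<longrightarrow>
            (\<forall>n\<ge>1. zero_forcing_number (iter_line_digraph n G)
                     = power_domination_number (iter_line_digraph (n + 1) G)
                 \<and> power_domination_number (iter_line_digraph (n + 1) G)
                     = (d - 1) * d ^ (n - 1) * card (pverts G)))"
proof -
  interpret pair_fin_digraph G by fact
  interpret pair_regular_digraph G d using assms(4,5) by unfold_locales
  have G: "pair_strong_regular_digraph G d"
    using connected_imp_strongly_connected[OF assms(3)] by unfold_locales
  have Z: "zero_forcing_number (iter_line_digraph n G)
        = max 1 ((d - 1) * d ^ (n - 1) * card (pverts G))"
    and P: "power_domination_number (iter_line_digraph (n + 1) G)
        = max 1 ((d - 1) * d ^ (n - 1) * card (pverts G))" if "n \<ge> 1" for n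
    using that iter_line_digraph_numbers[OF G, of "n - 1"] by (simp_all add: mult.assoc)
  have "card (pverts G) \<ge> 1"
    using assms(2) pair_finite_verts by (simp add: Suc_le_eq card_gt_0_iff)
  then have "(d - 1) * d ^ (n - 1) * card (pverts G) \<ge> 1" if "d \<ge> 2" for n
    using that by (simp add: Suc_le_eq)
  then show ?thesis using Z P by (simp add: max_def)
qed

end
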